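(* Let $\mathbf A=\langle A,\wedge,\vee,\star,\to,1,0\rangle$ be an algebra of type $(2,2,2,2,0,0)$. Then $\mathbf A$ is a residuated lattice if and only if there exists a finitary closure operator $C$ on $A$ satisfying the following properties for all $a,b,c\in A$: (T0) $C(a)=C(b)$ implies $a=b$. (T1) $a\to a\in C(\emptyset)$ and $1\in C(\emptyset)$. (T2) If $a\to b\in C(\emptyset)$ then $b\in C(a)$. (T3) $C(a\wedge b)=C(a,b)$. (T4) $C(a\vee b)=C(a)\cap C(b)$. (T6) $c\in C(a\star b)$ if and only if $b\to c\in C(a)$. (T7) $C\bigl(a\to(b\to c)\bigr)\subseteq C\bigl(b\to(a\to c)\bigr)$.
   Context: A residuated lattice (here always commutative and integral) is an algebra $\mathbf A=\langle A,\wedge,\vee,\star,\to,1,0\rangle$ such that $\langle A,\wedge,\vee\rangle$ is a lattice (order $\leqslant$) with maximum $1$, $\langle A,\star,1\rangle$ is a commutative monoid, and $a\star b\leqslant c \iff b\leqslant a\to c$ for all $a,b,c\in A$; nothing is assumed about $0$. A closure operator on $A$ is a map $C:\mathcal P(A)\to\mathcal P(A)$ that is extensive, monotone and idempotent; it is finitary if $C(X)=\bigcup\{C(Y):Y\subseteq X,\ Y\text{ finite}\}$ for all $X\subseteq A$. One writes $C(a)$ for $C(\{a\})$ and $C(a,b)$ for $C(\{a,b\})$. *)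

theory Defs
  imports Main
begin

text \<open>
  An algebra of type (2,2,2,2,0,0) is given by its six operations on a type; the type is the
  universe \<open>A\<close>, so the operations are total and the algebra is an arbitrary one.
\<close>

definition alg_le :: "('a \<Rightarrow> 'a \<Rightarrow> 'a) \<Rightarrow> 'a \<Rightarrow> 'a \<Rightarrow> bool" where
  "alg_le meet a b \<longleftrightarrow> meet a b = a"

definition alg_less :: "('a \<Rightarrow> 'a \<Rightarrow> 'a) \<Rightarrow> 'a \<Rightarrow> 'a \<Rightarrow> bool" where
  "alg_less meet a b \<longleftrightarrow> alg_le meet a b \<and> a \<noteq> b"

text \<open>
  The predicate \<open>class.lattice\<close> of the library takes the order as an argument; here this
  is the order induced by \<open>meet\<close>. Nothing is required of \<open>zero\<close>.
\<close>

definition residuated_lattice ::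
  "('a \<Rightarrow> 'a \<Rightarrow> 'a) \<Rightarrow> ('a \<Rightarrow> 'a \<Rightarrow> 'a) \<Rightarrow> ('a \<Rightarrow> 'a \<Rightarrow> 'a) \<Rightarrow> ('a \<Rightarrow> 'a \<Rightarrow> 'a) \<Rightarrow> 'a \<Rightarrow> 'a \<Rightarrow> bool"
where
  "residuated_lattice meet join star imp one zero \<longleftrightarrow>
     class.lattice meet (alg_le meet) (alg_less meet) join \<and>
     (\<forall>a. alg_le meet a one) \<and>
     comm_monoid star one \<and>
     (\<forall>a b c. alg_le meet (star a b) c \<longleftrightarrow> alg_le meet b (imp a c))"

definition closure_operator :: "('a set \<Rightarrow> 'a set) \<Rightarrow> bool" where
  "closure_operator C \<longleftrightarrow> (\<forall>X. X \<subseteq> C X) \<and> mono C \<and> (\<forall>X. C (C X) = C X)"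

definition finitary :: "('a set \<Rightarrow> 'a set) \<Rightarrow> bool" where
  "finitary C \<longleftrightarrow> (\<forall>X. C X = \<Union> {C Y |Y. Y \<subseteq> X \<and> finite Y})"

end

theory Submission
  imports Defs
begin

text \<open>
  For a residuated lattice, the operator of generating a lattice filter (containing \<open>1\<close>)
  has all the properties: the filter generated by \<open>a\<close> is the up-set of \<open>a\<close>.
  Conversely, (T0) and (T3) make \<open>a \<le> b\<close> equivalent to \<open>b \<in> C(a)\<close>, so by (T3) and (T4)
  the algebra is a lattice. (T1), (T2) and (T6) give \<open>1 \<star> a = a\<close>, by (T0) and (T7)
  premises of implications can be exchanged, and an element is determined by its upper bounds,
  so that (T6) turns the exchange law into commutativity and associativity of \<open>\<star>\<close>.
\<close>

text \<open>Nonempty filters, with upward closure encoded as one direction of the equivalence.\<close>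

definition lattice_filter :: "('a \<Rightarrow> 'a \<Rightarrow> 'a) \<Rightarrow> 'a \<Rightarrow> 'a set \<Rightarrow> bool" where
  "lattice_filter meet one F \<longleftrightarrow>
     one \<in> F \<and> (\<forall>x y. meet x y \<in> F \<longleftrightarrow> x \<in> F \<and> y \<in> F)"

definition filter_closure :: "('a \<Rightarrow> 'a \<Rightarrow> 'a) \<Rightarrow> 'a \<Rightarrow> 'a set \<Rightarrow> 'a set" where
  "filter_closure meet one X = \<Inter> {F. lattice_filter meet one F \<and> X \<subseteq> F}"

lemma filter_closure_extensive: "X \<subseteq> filter_closure meet one X"
  unfolding filter_closure_def by blast

lemma lattice_filter_filter_closure: "lattice_filter meet one (filter_closure meet one X)"
  unfolding filter_closure_def lattice_filter_def by blast

text \<open>Leastness of the generated filter, in the form that reduces an inclusion of closures to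
  one of generators.\<close>

lemma filter_closure_subset_iff:
  assumes "lattice_filter meet one F"
  shows "filter_closure meet one X \<subseteq> F \<longleftrightarrow> X \<subseteq> F"
  using assms filter_closure_extensive[of X meet one] unfolding filter_closure_def by blast

lemma filter_closure_mono:
  assumes "X \<subseteq> Y"
  shows "filter_closure meet one X \<subseteq> filter_closure meet one Y"
  using assms unfolding filter_closure_def by blast

lemma closure_operator_filter_closure: "closure_operator (filter_closure meet one)"
proof -
  have "filter_closure meet one (filter_closure meet one X) = filter_closure meet one X" for X
    by (meson filter_closure_extensive filter_closure_subset_iff lattice_filter_filter_closure
        order_refl subset_antisym)
  then show ?thesis
    unfolding closure_operator_def
    by (simp add: filter_closure_extensive filter_closure_mono monoI)
qed

text \<open>The closures of the finite subsets of \<open>X\<close> form a directed family, since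
  those of \<open>Y\<close> and \<open>Z\<close> lie in that of \<open>Y \<union> Z\<close>. Their
  union is therefore a filter, and it contains \<open>X\<close>.\<close>

lemma finitary_filter_closure: "finitary (filter_closure meet one)"
  unfolding finitary_def
proof
  fix X :: "'a set"
  let ?C = "filter_closure meet one"
  let ?U = "\<Union> {?C Y |Y. Y \<subseteq> X \<and> finite Y}"
  have "lattice_filter meet one ?U"
    unfolding lattice_filter_def
  proof (intro conjI allI iffI)
    show "one \<in> ?U"
      using lattice_filter_filter_closure[of meet one "{}"] unfolding lattice_filter_def by blast
  next
    fix x y assume "meet x y \<in> ?U"
    then show "x \<in> ?U" "y \<in> ?U"
      using lattice_filter_filter_closure[of meet one] unfolding lattice_filter_def by blast+
  next
    fix x y assume "x \<in> ?U \<and> y \<in> ?U"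
    then obtain Y Z where Y: "x \<in> ?C Y" "Y \<subseteq> X" "finite Y" and Z: "y \<in> ?C Z" "Z \<subseteq> X" "finite Z"
      by blast
    have "x \<in> ?C (Y \<union> Z)" "y \<in> ?C (Y \<union> Z)"
      using Y(1) Z(1) filter_closure_mono[of Y "Y \<union> Z"] filter_closure_mono[of Z "Y \<union> Z"] by blast+
    then have "meet x y \<in> ?C (Y \<union> Z)"
      using lattice_filter_filter_closure[of meet one "Y \<union> Z"] unfolding lattice_filter_def by blast
    moreover have "Y \<union> Z \<subseteq> X" "finite (Y \<union> Z)"
      using Y Z by auto
    ultimately show "meet x y \<in> ?U"
      by blast
  qed
  moreover have "X \<subseteq> ?U"
  proof
    fix x assume "x \<in> X"
    then have "{x} \<subseteq> X" "finite {x}" by simp_all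
    moreover have "x \<in> ?C {x}"
      using filter_closure_extensive[of "{x}"] by simp
    ultimately show "x \<in> ?U"
      by blast
  qed
  ultimately have "?C X \<subseteq> ?U"
    by (simp only: filter_closure_subset_iff)
  moreover have "?U \<subseteq> ?C X"
    using filter_closure_mono[of _ X meet one] by blast
  ultimately show "?C X = ?U"
    by blast
qed

text \<open>Both sides intersect the same family of filters, because the equivalence that defines a
  filter trades \<open>meet a b\<close> for the pair \<open>a\<close>, \<open>b\<close>.\<close>

lemma filter_closure_meet: "filter_closure meet one {meet a b} = filter_closure meet one {a, b}"
proof -
  have "{F. lattice_filter meet one F \<and> {meet a b} \<subseteq> F} = {F. lattice_filter meet one F \<and> {a, b} \<subseteq> F}"
    unfolding lattice_filter_def by auto
  then show ?thesis
    unfolding filter_closure_def by simp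
qed

text \<open>The up-set of \<open>a\<close> is a filter that contains \<open>a\<close>. Conversely,
  if \<open>meet a x = a\<close>, then every filter containing \<open>a\<close> contains
  \<open>meet a x\<close> and hence \<open>x\<close>.\<close>

lemma filter_closure_singleton:
  assumes "class.semilattice_inf meet (alg_le meet) (alg_less meet)" and "\<forall>x. alg_le meet x one"
  shows "filter_closure meet one {a} = {x. alg_le meet a x}"
proof
  interpret semilattice_inf meet "alg_le meet" "alg_less meet" by fact
  have "lattice_filter meet one {x. alg_le meet a x}"
    unfolding lattice_filter_def using assms(2) by simp
  then show "filter_closure meet one {a} \<subseteq> {x. alg_le meet a x}"
    by (simp add: filter_closure_subset_iff)
  show "{x. alg_le meet a x} \<subseteq> filter_closure meet one {a}"
  proof
    fix x assume "x \<in> {x. alg_le meet a x}"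
    then have "meet a x = a"
      by (simp add: alg_le_def)
    then show "x \<in> filter_closure meet one {a}"
      using lattice_filter_filter_closure[of meet one "{a}"] filter_closure_extensive[of "{a}" meet one]
      unfolding lattice_filter_def by (metis insert_subset)
  qed
qed

theorem theorem5p1:
  fixes meet join star imp :: "'a \<Rightarrow> 'a \<Rightarrow> 'a" and one zero :: 'a
  shows "residuated_lattice meet join star imp one zero \<longleftrightarrow>
    (\<exists>C :: 'a set \<Rightarrow> 'a set. closure_operator C \<and> finitary C \<and>
      (\<forall>a b. C {a} = C {b} \<longrightarrow> a = b) \<and>
      (\<forall>a. imp a a \<in> C {} \<and> one \<in> C {}) \<and>
      (\<forall>a b. imp a b \<in> C {} \<longrightarrow> b \<in> C {a}) \<and>
      (\<forall>a b. C {meet a b} = C {a, b}) \<and>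
      (\<forall>a b. C {join a b} = C {a} \<inter> C {b}) \<and>
      (\<forall>a b c. c \<in> C {star a b} \<longleftrightarrow> imp b c \<in> C {a}) \<and>
      (\<forall>a b c. C {imp a (imp b c)} \<subseteq> C {imp b (imp a c)}))"
    (is "_ \<longleftrightarrow> (\<exists>C. ?P C)")
proof
  assume RL: "residuated_lattice meet join star imp one zero"
  interpret lattice meet "alg_le meet" "alg_less meet" join
    using RL by (simp add: residuated_lattice_def)
  interpret comm_monoid star one
    using RL by (simp add: residuated_lattice_def)
  have top: "alg_le meet a one" for a
    using RL by (simp add: residuated_lattice_def)
  have res: "alg_le meet (star a b) c \<longleftrightarrow> alg_le meet b (imp a c)" for a b c
    using RL by (simp add: residuated_lattice_def)
  let ?C = "filter_closure meet one"
  have C: "?C {a} = {x. alg_le meet a x}" for a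
    by (rule filter_closure_singleton) (use top semilattice_inf_axioms in auto)
  have one: "one \<in> ?C {}"
    using lattice_filter_filter_closure unfolding lattice_filter_def by fast
  have imp_one: "alg_le meet one (imp a b) \<longleftrightarrow> alg_le meet a b" for a b
    using res[of a one b] by simp
  have imp_self: "imp a a = one" for a
    by (intro order.antisym top) (simp add: imp_one)
  have "?P ?C"
  proof (intro conjI allI impI)
    show "closure_operator ?C" "finitary ?C"
      by (fact closure_operator_filter_closure finitary_filter_closure)+
    show "a = b" if "?C {a} = ?C {b}" for a b
      using that by (auto simp: C set_eq_iff intro: order.antisym)
    show "imp a a \<in> ?C {}" "one \<in> ?C {}" for a
      using one by (simp_all add: imp_self)
    show "b \<in> ?C {a}" if "imp a b \<in> ?C {}" for a b
      using that filter_closure_mono[of "{}" "{one}" meet one] by (auto simp: C imp_one)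
    show "?C {meet a b} = ?C {a, b}" for a b
      by (rule filter_closure_meet)
    show "?C {join a b} = ?C {a} \<inter> ?C {b}" for a b
      by (auto simp: C)
    \<comment> \<open>Residuation moves the left factor and (T6) the right one; commutativity
      reconciles them.\<close>
    show "c \<in> ?C {star a b} \<longleftrightarrow> imp b c \<in> ?C {a}" for a b c
      using res[of b a c] by (simp add: C commute)
    show "?C {imp a (imp b c)} \<subseteq> ?C {imp b (imp a c)}" for a b c
    proof -
      \<comment> \<open>By residuation, each side says that the product of \<open>a\<close>,
        \<open>b\<close> and \<open>x\<close> is below \<open>c\<close>. Elements with the same
        lower bounds are equal.\<close>
      have "alg_le meet x (imp b (imp a c)) \<longleftrightarrow> alg_le meet x (imp a (imp b c))" for x
        by (simp add: res[symmetric] left_commute)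
      then have "imp b (imp a c) = imp a (imp b c)"
        by (intro order.antisym) (metis order.refl)+
      then show ?thesis by simp
    qed
  qed
  then show "\<exists>C. ?P C" by blast
next
  assume "\<exists>C. ?P C"
  then obtain C :: "'a set \<Rightarrow> 'a set" where C: "?P C" by blast
  then have ext: "X \<subseteq> C X" and mono: "X \<subseteq> Y \<Longrightarrow> C X \<subseteq> C Y" and idem: "C (C X) = C X" for X Y
    by (auto simp: closure_operator_def mono_def)
  from C have T0: "C {a} = C {b} \<Longrightarrow> a = b"
    and T1: "imp a a \<in> C {}" "one \<in> C {}"
    and T2: "imp a b \<in> C {} \<Longrightarrow> b \<in> C {a}"
    and T3: "C {meet a b} = C {a, b}"
    and T4: "C {join a b} = C {a} \<inter> C {b}"
    and T6: "c \<in> C {star a b} \<longleftrightarrow> imp b c \<in> C {a}"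
    and T7: "C {imp a (imp b c)} \<subseteq> C {imp b (imp a c)}" for a b c
    by blast+
  have subset_iff: "C X \<subseteq> C Y \<longleftrightarrow> X \<subseteq> C Y" for X Y
    using ext[of X] mono[of X "C Y"] idem[of Y] by auto
  have refl: "a \<in> C {a}" for a
    using ext[of "{a}"] by simp
  have le: "alg_le meet a b \<longleftrightarrow> b \<in> C {a}" for a b
  proof
    assume "alg_le meet a b"
    then show "b \<in> C {a}"
      using T3[of a b] ext[of "{a, b}"] by (simp add: alg_le_def)
  next
    assume "b \<in> C {a}"
    \<comment> \<open>Adding \<open>b\<close> does not enlarge the closure of \<open>{a}\<close>, so
      by (T3) \<open>meet a b\<close> and \<open>a\<close> have the same closure.\<close>
    then have "C {a, b} \<subseteq> C {a}"
      by (simp add: subset_iff refl)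
    then have "C {meet a b} = C {a}"
      using mono[of "{a}" "{a, b}"] by (simp add: T3 subset_antisym)
    then show "alg_le meet a b"
      unfolding alg_le_def by (rule T0)
  qed
  have trans: "c \<in> C {a}" if "b \<in> C {a}" "c \<in> C {b}" for a b c
    using that subset_iff[of "{b}" "{a}"] by auto
  have antisym: "a = b" if "b \<in> C {a}" "a \<in> C {b}" for a b
    using that by (intro T0 subset_antisym) (simp_all add: subset_iff)
  have eqI: "a = b" if "\<And>x. x \<in> C {a} \<longleftrightarrow> x \<in> C {b}" for a b
    using that by (intro T0) blast
  have lattice: "class.lattice meet (alg_le meet) (alg_less meet) join"
  proof
    fix x y z
    show "alg_less meet x y \<longleftrightarrow> alg_le meet x y \<and> \<not> alg_le meet y x"
      using antisym refl by (auto simp: alg_less_def le)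
    show "alg_le meet x x"
      by (simp add: le refl)
    show "alg_le meet x z" if "alg_le meet x y" "alg_le meet y z"
      using that trans by (auto simp: le)
    show "x = y" if "alg_le meet x y" "alg_le meet y x"
      using that antisym by (auto simp: le)
    show "alg_le meet (meet x y) x" "alg_le meet (meet x y) y"
      using ext[of "{x, y}"] by (auto simp: le T3)
    show "alg_le meet x (meet y z)" if "alg_le meet x y" "alg_le meet x z"
      using that T3[of y z] refl[of "meet y z"] subset_iff[of "{y, z}" "{x}"] by (auto simp: le)
    show "alg_le meet x (join x y)" "alg_le meet y (join x y)"
      using T4[of x y] refl[of "join x y"] by (auto simp: le)
    show "alg_le meet (join y z) x" if "alg_le meet y x" "alg_le meet z x"
      using that by (simp add: le T4)
  qed
  have top: "one \<in> C {a}" for a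
    using T1(2) mono[of "{}" "{a}"] by auto
  have "C {one} = C {}"
    using T1(2) by (intro subset_antisym) (simp_all add: subset_iff)
  \<comment> \<open>By (T6), \<open>x \<in> C {star one b}\<close> means
    \<open>imp b x \<in> C {}\<close>. Taking \<open>x\<close> to be \<open>b\<close>, (T1) gives
    one inequality; taking \<open>x\<close> to be \<open>star one b\<close>, (T2) gives the
    other.\<close>
  then have one_star: "star one b = b" for b
    using T6[of _ one b] T1(1)[of b] T2[of b] refl[of "star one b"] by (intro antisym) auto
  have exchange: "imp a (imp b c) = imp b (imp a c)" for a b c
    by (intro T0 subset_antisym T7)
  \<comment> \<open>The unit law turns (T6) into (T2) together with its converse.\<close>
  have imp_iff: "imp a b \<in> C {one} \<longleftrightarrow> b \<in> C {a}" for a b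
    using T6[of b one a] by (simp add: one_star)
  \<comment> \<open>Both memberships become nested implications in \<open>C {one}\<close>, where the
    exchange law swaps the premises.\<close>
  have adj: "imp b c \<in> C {a} \<longleftrightarrow> imp a c \<in> C {b}" for a b c
    using imp_iff[of a "imp b c"] imp_iff[of b "imp a c"] exchange[of a b c] by simp
  have comm: "star a b = star b a" for a b
    by (rule eqI) (simp add: T6 adj)
  have assoc: "star (star a b) c = star a (star b c)" for a b c
  proof (rule eqI)
    fix d
    \<comment> \<open>The chain aims at the rotated product \<open>star (star b c) a\<close>, since
      (T6) unfolds left-nested products into nested implications; commutativity then moves
      \<open>a\<close> to the front.\<close>
    have "d \<in> C {star (star a b) c} \<longleftrightarrow> imp b (imp c d) \<in> C {a}"
      by (simp add: T6)
    also have "\<dots> \<longleftrightarrow> imp c (imp a d) \<in> C {b}"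
      by (simp add: adj[of b] exchange[of a])
    also have "\<dots> \<longleftrightarrow> d \<in> C {star (star b c) a}"
      by (simp add: T6)
    also have "star (star b c) a = star a (star b c)"
      by (rule comm)
    finally show "d \<in> C {star (star a b) c} \<longleftrightarrow> d \<in> C {star a (star b c)}" .
  qed
  have "comm_monoid star one"
    by unfold_locales (simp_all add: assoc comm[of _ one] one_star, rule comm)
  \<comment> \<open>Residuation with the left factor moved, obtained from (T6) through
    \<open>adj\<close>.\<close>
  moreover have "c \<in> C {star a b} \<longleftrightarrow> imp a c \<in> C {b}" for a b c
    using T6 adj by blast
  ultimately show "residuated_lattice meet join star imp one zero"
    unfolding residuated_lattice_def using lattice top by (simp add: le)
qed

end
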